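(* Let $k$ be a positive integer, let $\varepsilon$ be a positive real number, and let $G$ be a connected non-complete graph of even order with $t(G)\geq 1+\varepsilon$. If $\kappa(G)>\frac{(2k-2)(1+\varepsilon)}{\varepsilon}$, then $G$ is $k$-extendable.
   Context: All graphs are finite, simple and connected. The order of $G$ is $|V(G)|$, $\kappa(G)$ denotes the vertex connectivity of $G$, and $c(H)$ denotes the number of connected components of a graph $H$. For a non-complete graph $G$, the toughness is $t(G)=\min \frac{|S|}{c(G-S)}$, the minimum taken over all vertex cut-sets $S\subset V(G)$ (sets $S$ for which $G-S$ is disconnected). A matching is a set of pairwise independent (vertex-disjoint) edges; a $k$-matching is a matching with exactly $k$ edges; a perfect matching is a matching covering all vertices. A connected graph $G$ with a perfect matching and $|V(G)|\geq 2k+2$ is called $k$-extendable if every $k$-matching of $G$ is contained in a perfect matching of $G$. *)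

theory Defs
  imports Complex_Main "Graph_Theory.Graph_Theory"
begin

text \<open>
  A finite simple graph is a symmetric, loop-free digraph without parallel arcs
  (\<^locale>\<open>Digraph.graph\<close>). Each undirected edge is represented by two opposite arcs, so
  undirected edges, and hence matchings, are taken as two-element sets of vertices.
\<close>

definition delete_verts :: "('a, 'b) pre_digraph \<Rightarrow> 'a set \<Rightarrow> ('a, 'b) pre_digraph" where
  "delete_verts G S = G \<restriction> (verts G - S)"

text \<open>
  The strongly connected components of a symmetric digraph are the connected components of
  the undirected graph it represents.
\<close>

definition num_components :: "('a, 'b) pre_digraph \<Rightarrow> nat" where
  "num_components H = card (pre_digraph.sccs H)"

text \<open>
  \<^const>\<open>Digraph_Component.connected\<close> is false for the graph without vertices, so deleting all
  vertices has to be ruled out separately.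
\<close>

definition vertex_cut :: "('a, 'b) pre_digraph \<Rightarrow> 'a set \<Rightarrow> bool" where
  "vertex_cut G S \<longleftrightarrow>
     S \<subset> verts G \<and> \<not> Digraph_Component.connected (delete_verts G S)"

definition is_complete :: "('a, 'b) pre_digraph \<Rightarrow> bool" where
  "is_complete G \<longleftrightarrow> complete_digraph (card (verts G)) G"

text \<open>Only meaningful for non-complete graphs: a complete graph has no vertex cut.\<close>

definition toughness :: "('a, 'b) pre_digraph \<Rightarrow> real" where
  "toughness G =
     Min {real (card S) / real (num_components (delete_verts G S)) | S. vertex_cut G S}"

text \<open>
  The least number of vertices whose deletion leaves a disconnected graph or a single vertex;
  the second alternative gives the usual value \<open>n - 1\<close> for the complete graph on \<open>n\<close> vertices.
\<close>

definition vertex_connectivity :: "('a, 'b) pre_digraph \<Rightarrow> nat" where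
  "vertex_connectivity G =
     Min {card S | S. S \<subseteq> verts G \<and> (vertex_cut G S \<or> card (verts G - S) = 1)}"

definition edges :: "('a, 'b) pre_digraph \<Rightarrow> 'a set set" where
  "edges G = (\<lambda>e. {tail G e, head G e}) ` arcs G"

definition matching :: "('a, 'b) pre_digraph \<Rightarrow> 'a set set \<Rightarrow> bool" where
  "matching G M \<longleftrightarrow> M \<subseteq> edges G \<and> pairwise disjnt M"

definition k_matching :: "('a, 'b) pre_digraph \<Rightarrow> nat \<Rightarrow> 'a set set \<Rightarrow> bool" where
  "k_matching G k M \<longleftrightarrow> matching G M \<and> finite M \<and> card M = k"

definition perfect_matching :: "('a, 'b) pre_digraph \<Rightarrow> 'a set set \<Rightarrow> bool" where
  "perfect_matching G M \<longleftrightarrow> matching G M \<and> \<Union>M = verts G"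

definition k_extendable :: "('a, 'b) pre_digraph \<Rightarrow> nat \<Rightarrow> bool" where
  "k_extendable G k \<longleftrightarrow>
     Digraph_Component.connected G \<and> (\<exists>M. perfect_matching G M) \<and>
     card (verts G) \<ge> 2 * k + 2 \<and>
     (\<forall>M. k_matching G k M \<longrightarrow> (\<exists>M'. perfect_matching G M' \<and> M \<subseteq> M'))"

end

theory Submission
  imports Defs
begin

text \<open>
  If a matching \<open>M\<close> with \<open>j \<le> k\<close> edges does not extend to a perfect matching, Tutte's theorem
  for \<open>G - \<Union>M\<close> and a parity count give a set \<open>T\<close> such that \<open>G - (\<Union>M \<union> T)\<close> has at least
  \<open>|T| + 2\<close> components. For \<open>S = \<Union>M \<union> T\<close>, of size \<open>|T| + 2j\<close>, toughness gives
  \<open>|S| \<ge> (1 + \<epsilon>)(|S| - 2j + 2)\<close>, that is \<open>|S| \<le> (2j - 2)(1 + \<epsilon>)/\<epsilon> < \<kappa>(G)\<close>, although \<open>S\<close> is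
  a vertex cut. The case \<open>j = 0\<close> provides the perfect matching required by extendability.

  Tutte's theorem is proved by Anderson's induction: for a maximal \<open>S\<close> such that \<open>G - S\<close> has
  exactly \<open>|S|\<close> odd components, all components are odd and become perfectly matchable after
  removing any vertex, and Hall's theorem matches the components with \<open>S\<close>.
\<close>

section \<open>Hall's marriage theorem\<close>

text \<open>Induction on the number of sets. If some nonempty proper subfamily is tight, it is
  represented first and the remaining sets use only elements outside its union. Otherwise each such
  subfamily has a surplus element, so one arbitrary choice \<open>x\<close> for one index
  \<open>i\<close> can be spared.\<close>

lemma hall_marriage:
  fixes A :: "'i \<Rightarrow> 'b set"
  assumes "finite I" and "\<And>i. i \<in> I \<Longrightarrow> finite (A i)"
    and "\<And>J. J \<subseteq> I \<Longrightarrow> card J \<le> card (\<Union>(A ` J))"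
  shows "\<exists>R. (\<forall>i\<in>I. R i \<in> A i) \<and> inj_on R I"
  using assms
proof (induction "card I" arbitrary: I A rule: less_induct)
  case less
  note hall = less.prems(3)
  have fin: "finite (\<Union>(A ` J))" "finite J" if "J \<subseteq> I" for J
    using that less.prems(1,2) by (auto intro: finite_subset)
  show ?case
  proof (cases "\<exists>J. J \<noteq> {} \<and> J \<subset> I \<and> card (\<Union>(A ` J)) = card J")
    case True
    then obtain J where J: "J \<noteq> {}" "J \<subset> I" "card (\<Union>(A ` J)) = card J"
      by blast
    define B where "B = \<Union>(A ` J)"
    have "\<exists>R. (\<forall>i\<in>J. R i \<in> A i) \<and> inj_on R J"
    proof (rule less.hyps)
      show "card J < card I"
        using J less.prems(1) by (intro psubset_card_mono)
    qed (use J less.prems in \<open>auto intro: finite_subset\<close>)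
    then obtain R1 where R1: "\<forall>i\<in>J. R1 i \<in> A i" "inj_on R1 J"
      by blast
    have "\<exists>R. (\<forall>i\<in>I - J. R i \<in> A i - B) \<and> inj_on R (I - J)"
    proof (rule less.hyps)
      show "card (I - J) < card I"
        using J less.prems(1) by (intro psubset_card_mono) auto
      fix K assume K: "K \<subseteq> I - J"
      \<comment> \<open>Hall's condition for \<open>J \<union> K\<close> leaves at least
        \<open>card K\<close> elements outside \<open>B\<close>, because \<open>B\<close> has
        exactly \<open>card J\<close> elements.\<close>
      have "card J + card K = card (J \<union> K)"
        using K J fin[of J] fin[of K] by (subst card_Un_disjoint) auto
      also have "\<dots> \<le> card (\<Union>(A ` (J \<union> K)))"
        using K J by (intro hall) auto
      also have "\<Union>(A ` (J \<union> K)) = B \<union> \<Union>((\<lambda>i. A i - B) ` K)"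
        by (auto simp: B_def)
      also have "card \<dots> \<le> card B + card (\<Union>((\<lambda>i. A i - B) ` K))"
        by (rule card_Un_le)
      finally show "card K \<le> card (\<Union>((\<lambda>i. A i - B) ` K))"
        using J by (simp add: B_def)
    qed (use less.prems in auto)
    then obtain R2 where R2: "\<forall>i\<in>I - J. R2 i \<in> A i - B" "inj_on R2 (I - J)"
      by blast
    define R where "R = (\<lambda>i. if i \<in> J then R1 i else R2 i)"
    have "R1 i \<noteq> R2 j" if "i \<in> J" "j \<in> I - J" for i j
    proof -
      have "R1 i \<in> B" using R1 that by (auto simp: B_def)
      moreover have "R2 j \<notin> B" using R2 that by blast
      ultimately show ?thesis by metis
    qed
    then have "inj_on R I"
      using R1(2) R2(2) unfolding inj_on_def R_def by (metis DiffI)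
    moreover have "\<forall>i\<in>I. R i \<in> A i"
      using R1 R2 by (auto simp: R_def)
    ultimately show ?thesis by blast
  next
    case False
    show ?thesis
    proof (cases "I = {}")
      case True
      then show ?thesis by simp
    next
      case False
      then obtain i where i: "i \<in> I" by blast
      then have "A i \<noteq> {}"
        using hall[of "{i}"] by auto
      then obtain x where x: "x \<in> A i" by blast
      have "\<exists>R. (\<forall>j\<in>I - {i}. R j \<in> A j - {x}) \<and> inj_on R (I - {i})"
      proof (rule less.hyps)
        show "card (I - {i}) < card I"
          using i less.prems(1) by (intro psubset_card_mono) auto
        fix K assume K: "K \<subseteq> I - {i}"
        show "card K \<le> card (\<Union>((\<lambda>j. A j - {x}) ` K))"
        proof (cases "K = {}")
          case False
          have "card K \<le> card (\<Union>(A ` K))"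
            using K by (intro hall) auto
          \<comment> \<open>\<open>K\<close> is nonempty and misses \<open>i\<close>, so it is a
            proper subfamily and not tight; the surplus absorbs the loss of
            \<open>x\<close>.\<close>
          moreover have "card (\<Union>(A ` K)) \<noteq> card K"
            using \<open>\<not> (\<exists>J. J \<noteq> {} \<and> J \<subset> I \<and> card (\<Union>(A ` J)) = card J)\<close> False K i
            by blast
          moreover have "card (\<Union>(A ` K)) - 1 \<le> card (\<Union>(A ` K) - {x})"
            by (simp add: card_Diff_singleton_if)
          ultimately have "card K \<le> card (\<Union>(A ` K) - {x})" by linarith
          also have "\<Union>(A ` K) - {x} = \<Union>((\<lambda>j. A j - {x}) ` K)" by auto
          finally show ?thesis .
        qed simp
      qed (use less.prems in auto)
      then obtain R where R: "\<forall>j\<in>I - {i}. R j \<in> A j - {x}" "inj_on R (I - {i})"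
        by blast
      have "inj_on (R(i := x)) (insert i (I - {i}))"
        unfolding inj_on_insert using R by (auto simp: inj_on_def)
      then have "inj_on (R(i := x)) I"
        using i by (simp add: insert_absorb)
      moreover have "\<forall>j\<in>I. (R(i := x)) j \<in> A j"
        using R x by auto
      ultimately show ?thesis by blast
    qed
  qed
qed

section \<open>Components of a relation on a vertex set\<close>

text \<open>A graph is represented by a relation together with a vertex set, so deleting vertices is
  set difference and the induction for Tutte's theorem varies only the set.\<close>

definition closed_in :: "('a \<Rightarrow> 'a \<Rightarrow> bool) \<Rightarrow> 'a set \<Rightarrow> 'a set \<Rightarrow> bool" where
  "closed_in E X D \<longleftrightarrow> D \<subseteq> X \<and> (\<forall>x\<in>D. \<forall>y\<in>X - D. \<not> E x y)"

text \<open>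
  The closed subsets of \<open>X\<close> form a Boolean algebra when \<open>E\<close> is symmetric; its atoms are the vertex
  sets of the connected components of the graph that \<open>E\<close> induces on \<open>X\<close>.
\<close>

definition comps :: "('a \<Rightarrow> 'a \<Rightarrow> bool) \<Rightarrow> 'a set \<Rightarrow> 'a set set" where
  "comps E X =
     {C. C \<noteq> {} \<and> closed_in E X C \<and> (\<forall>D. D \<noteq> {} \<longrightarrow> D \<subseteq> C \<longrightarrow> closed_in E X D \<longrightarrow> D = C)}"

definition odd_comps :: "('a \<Rightarrow> 'a \<Rightarrow> bool) \<Rightarrow> 'a set \<Rightarrow> 'a set set" where
  "odd_comps E X = {C \<in> comps E X. odd (card C)}"

text \<open>The equation \<open>\<Union>M = X\<close> also confines the matching edges to
  \<open>X\<close>, although \<open>E\<close> itself is not restricted.\<close>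

definition has_perfect_matching :: "('a \<Rightarrow> 'a \<Rightarrow> bool) \<Rightarrow> 'a set \<Rightarrow> bool" where
  "has_perfect_matching E X \<longleftrightarrow> (\<exists>M. M \<subseteq> {{x, y} | x y. E x y} \<and> pairwise disjnt M \<and> \<Union>M = X)"

definition tutte_condition :: "('a \<Rightarrow> 'a \<Rightarrow> bool) \<Rightarrow> 'a set \<Rightarrow> bool" where
  "tutte_condition E X \<longleftrightarrow> (\<forall>S\<subseteq>X. card (odd_comps E (X - S)) \<le> card S)"

lemma comps_subset: "C \<in> comps E X \<Longrightarrow> C \<subseteq> X"
  by (auto simp: comps_def closed_in_def)

lemma comps_nonempty: "C \<in> comps E X \<Longrightarrow> C \<noteq> {}"
  by (auto simp: comps_def)

lemma comps_closed: "C \<in> comps E X \<Longrightarrow> closed_in E X C"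
  by (auto simp: comps_def)

lemma comps_minimal:
  "C \<in> comps E X \<Longrightarrow> D \<noteq> {} \<Longrightarrow> D \<subseteq> C \<Longrightarrow> closed_in E X D \<Longrightarrow> D = C"
  by (auto simp: comps_def)

lemma finite_comps: "finite X \<Longrightarrow> finite (comps E X)"
  by (rule finite_subset[of _ "Pow X"]) (auto dest: comps_subset)

lemma finite_odd_comps: "finite X \<Longrightarrow> finite (odd_comps E X)"
  by (simp add: finite_comps odd_comps_def)

lemma closed_in_Int: "closed_in E X C \<Longrightarrow> closed_in E X D \<Longrightarrow> closed_in E X (C \<inter> D)"
  by (auto simp: closed_in_def)

text \<open>The intersection is a nonempty closed part of the atom \<open>C\<close>, hence all of
  \<open>C\<close> by minimality.\<close>

lemma comps_subset_closed:
  assumes "C \<in> comps E X" "closed_in E X D" "C \<inter> D \<noteq> {}"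
  shows "C \<subseteq> D"
  using comps_minimal[of C E X "C \<inter> D"] closed_in_Int[OF comps_closed] assms by blast

lemma comps_disjoint:
  assumes "C \<in> comps E X" "D \<in> comps E X" "C \<noteq> D"
  shows "C \<inter> D = {}"
  using comps_subset_closed[of C E X D] comps_subset_closed[of D E X C] assms
  by (auto dest: comps_closed)

lemma closed_in_Diff:
  assumes "symp E" "closed_in E X D"
  shows "closed_in E X (X - D)"
  using assms by (auto simp: closed_in_def dest: sympD)

lemma closed_in_self: "closed_in E X X"
  by (simp add: closed_in_def)

lemma closed_in_trans: "closed_in E X A \<Longrightarrow> closed_in E A D \<Longrightarrow> closed_in E X D"
  unfolding closed_in_def by blast

lemma closed_in_subset: "closed_in E X D \<Longrightarrow> D \<subseteq> A \<Longrightarrow> A \<subseteq> X \<Longrightarrow> closed_in E A D"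
  unfolding closed_in_def by blast

text \<open>The closed subsets of \<open>A\<close> are exactly the closed subsets of
  \<open>X\<close> contained in \<open>A\<close>, so minimality means the same in both.\<close>

lemma comps_of_closed:
  assumes "closed_in E X A"
  shows "comps E A = {C \<in> comps E X. C \<subseteq> A}"
proof -
  have "A \<subseteq> X" using assms by (simp add: closed_in_def)
  have "closed_in E A D \<longleftrightarrow> D \<subseteq> A \<and> closed_in E X D" for D
    using assms \<open>A \<subseteq> X\<close> closed_in_trans closed_in_subset by (metis closed_in_def)
  then show ?thesis
    unfolding comps_def by (intro set_eqI, simp only: mem_Collect_eq) (metis subset_trans)
qed

lemma comps_split:
  assumes "symp E" "closed_in E X A"
  shows "comps E X = comps E A \<union> comps E (X - A)"
proof -
  have "C \<subseteq> A \<or> C \<subseteq> X - A" if "C \<in> comps E X" for C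
    using comps_subset_closed[OF that assms(2)] comps_subset[OF that] by blast
  then show ?thesis
    using comps_of_closed[OF assms(2)] comps_of_closed[OF closed_in_Diff[OF assms]] by auto
qed

text \<open>This additivity isolates one component, so that the effect of deleting vertices inside
  it can be counted.\<close>

lemma card_odd_comps_split:
  assumes "symp E" "closed_in E X A" "finite X"
  shows "card (odd_comps E X) = card (odd_comps E A) + card (odd_comps E (X - A))"
proof -
  have "A \<subseteq> X" using assms by (simp add: closed_in_def)
  have "odd_comps E X = odd_comps E A \<union> odd_comps E (X - A)"
    using comps_split[OF assms(1,2)] by (auto simp: odd_comps_def)
  moreover have "odd_comps E A \<inter> odd_comps E (X - A) = {}"
  proof -
    have False if "C \<in> comps E A" "C \<in> comps E (X - A)" for C
      using comps_subset[OF that(1)] comps_subset[OF that(2)] comps_nonempty[OF that(1)] by blast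
    then show ?thesis by (auto simp: odd_comps_def)
  qed
  moreover have "finite (odd_comps E A)" "finite (odd_comps E (X - A))"
    using assms(3) \<open>A \<subseteq> X\<close> by (auto intro!: finite_odd_comps intro: finite_subset)
  ultimately show ?thesis by (simp add: card_Un_disjoint)
qed

text \<open>A minimal closed set \<open>C\<close> containing \<open>x\<close> is an atom: a nonempty
  closed \<open>D\<close> inside \<open>C\<close> that avoids \<open>x\<close> would make
  \<open>C - D\<close> a smaller closed set around \<open>x\<close>.\<close>

lemma Union_comps:
  assumes "symp E" "finite X"
  shows "\<Union>(comps E X) = X"
proof
  show "\<Union>(comps E X) \<subseteq> X" by (auto dest: comps_subset)
  show "X \<subseteq> \<Union>(comps E X)"
  proof
    fix x assume x: "x \<in> X"
    define F where "F = {D. closed_in E X D \<and> x \<in> D}"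
    have "X \<in> F" using x by (simp add: F_def closed_in_self)
    have "finite F"
      by (rule finite_subset[of _ "Pow X"]) (auto simp: F_def closed_in_def assms)
    then obtain C where C: "C \<in> F" and min: "\<And>D. D \<in> F \<Longrightarrow> D \<subseteq> C \<Longrightarrow> D = C"
      using finite_has_minimal[of F] \<open>X \<in> F\<close> by (metis empty_iff)
    have "closed_in E X C" "x \<in> C" using C by (auto simp: F_def)
    have "D = C" if D: "D \<noteq> {}" "D \<subseteq> C" "closed_in E X D" for D
    proof (cases "x \<in> D")
      case True
      then show ?thesis using D min by (simp add: F_def)
    next
      case False
      have "closed_in E X (C \<inter> (X - D))"
        using assms(1) D \<open>closed_in E X C\<close> by (intro closed_in_Int closed_in_Diff)
      then have "C \<inter> (X - D) = C"
        using False x \<open>x \<in> C\<close> by (intro min) (auto simp: F_def)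
      then show ?thesis using D by auto
    qed
    then have "C \<in> comps E X"
      using \<open>closed_in E X C\<close> \<open>x \<in> C\<close> by (auto simp: comps_def)
    then show "x \<in> \<Union>(comps E X)" using \<open>x \<in> C\<close> by blast
  qed
qed

text \<open>The component sizes add up to \<open>card X\<close>, and modulo 2 only the odd ones
  contribute.\<close>

lemma even_card_odd_comps:
  assumes "symp E" "finite X"
  shows "even (card (odd_comps E X)) \<longleftrightarrow> even (card X)"
proof -
  have "card X = (\<Sum>C\<in>comps E X. card C)"
    using assms comps_subset[of _ E X]
    by (subst Union_comps[symmetric, OF assms], subst card_Union_disjoint)
      (auto simp: pairwise_def disjnt_def comps_disjoint intro: finite_subset)
  then show ?thesis
    using finite_comps[OF assms(2)] by (simp add: even_sum_iff odd_comps_def)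
qed

lemma comps_self:
  assumes "C \<in> comps E X"
  shows "comps E C = {C}"
proof -
  have "D = C" if "D \<in> comps E X" "D \<subseteq> C" for D
    using comps_minimal[OF assms comps_nonempty that(2) comps_closed] that(1) by blast
  then show ?thesis
    using comps_of_closed[OF comps_closed[OF assms]] assms by blast
qed

section \<open>Gluing perfect matchings of disjoint sets\<close>

lemma has_perfect_matching_empty: "has_perfect_matching E {}"
  unfolding has_perfect_matching_def by (intro exI[of _ "{}"]) simp

lemma has_perfect_matching_pair: "E x y \<Longrightarrow> has_perfect_matching E {x, y}"
  unfolding has_perfect_matching_def by (intro exI[of _ "{{x, y}}"]) auto

lemma has_perfect_matching_Un:
  assumes "has_perfect_matching E A" "has_perfect_matching E B" "A \<inter> B = {}"
  shows "has_perfect_matching E (A \<union> B)"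
proof -
  obtain M where M: "M \<subseteq> {{x, y} | x y. E x y}" "pairwise disjnt M" "\<Union>M = A"
    using assms(1) unfolding has_perfect_matching_def by blast
  obtain N where N: "N \<subseteq> {{x, y} | x y. E x y}" "pairwise disjnt N" "\<Union>N = B"
    using assms(2) unfolding has_perfect_matching_def by blast
  have "disjnt e f" if "e \<in> M" "f \<in> N" for e f
    using that M(3) N(3) assms(3) unfolding disjnt_def by blast
  then have "pairwise disjnt (M \<union> N)"
    using M(2) N(2) unfolding pairwise_def by (metis Un_iff disjnt_sym)
  then show ?thesis
    unfolding has_perfect_matching_def using M N by (intro exI[of _ "M \<union> N"]) auto
qed

lemma has_perfect_matching_UN:
  assumes "finite I" "\<And>i. i \<in> I \<Longrightarrow> has_perfect_matching E (A i)"
    and "\<And>i j. i \<in> I \<Longrightarrow> j \<in> I \<Longrightarrow> i \<noteq> j \<Longrightarrow> A i \<inter> A j = {}"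
  shows "has_perfect_matching E (\<Union>i\<in>I. A i)"
  using assms
proof (induction I rule: finite_induct)
  case empty
  then show ?case by (simp add: has_perfect_matching_empty)
next
  case (insert i I)
  have "has_perfect_matching E (A i \<union> (\<Union>i\<in>I. A i))"
  proof (rule has_perfect_matching_Un)
    show "A i \<inter> (\<Union>i\<in>I. A i) = {}"
      using insert.hyps insert.prems(2) by fastforce
  qed (use insert in auto)
  then show ?case by simp
qed

section \<open>Tutte's theorem\<close>

theorem tutte_theorem:
  assumes "symp E" "finite X" "tutte_condition E X"
  shows "has_perfect_matching E X"
  using assms(2,3)
proof (induction "card X" arbitrary: X rule: less_induct)
  case less
  note fin = \<open>finite X\<close>
  have tutte: "card (odd_comps E (X - S)) \<le> card S" if "S \<subseteq> X" for S
    using less.prems(2) that by (simp add: tutte_condition_def)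
  define F where "F = {S. S \<subseteq> X \<and> card (odd_comps E (X - S)) = card S}"
  have "finite F"
    by (rule finite_subset[of _ "Pow X"]) (auto simp: F_def fin)
  \<comment> \<open>The condition for the empty set says that there are no odd components at all, so
    \<open>F\<close> is nonempty and has a maximal member.\<close>
  moreover have "{} \<in> F"
    using tutte[of "{}"] by (simp add: F_def)
  ultimately obtain S where "S \<in> F" and maxF: "\<And>T. T \<in> F \<Longrightarrow> S \<subseteq> T \<Longrightarrow> T = S"
    using finite_has_maximal[of F] by (metis empty_iff)
  then have S: "S \<subseteq> X" "card (odd_comps E (X - S)) = card S"
    by (auto simp: F_def)
  have maximal: "card (odd_comps E (X - T)) < card T" if "S \<subset> T" "T \<subseteq> X" for T
    using maxF[of T] tutte[of T] that by (fastforce simp: F_def)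
  \<comment> \<open>Both \<open>X - S\<close> and \<open>X - (S \<union> T)\<close> split into a
    part inside \<open>C\<close> and the common rest \<open>X - S - C\<close>. The contribution of
    the rest cancels; the sum form avoids truncated subtraction.\<close>
  have split: "card (odd_comps E (X - (S \<union> T))) + card (odd_comps E C)
      = card (odd_comps E (C - T)) + card S"
    if C: "C \<in> comps E (X - S)" and T: "T \<subseteq> C" for C T
  proof -
    let ?Y = "X - S"
    have cl: "closed_in E ?Y C" using C by (rule comps_closed)
    have "C \<subseteq> ?Y" using C by (rule comps_subset)
    have "closed_in E (?Y - T) (C - T)"
      using cl unfolding closed_in_def by blast
    then have "card (odd_comps E (?Y - T))
        = card (odd_comps E (C - T)) + card (odd_comps E ((?Y - T) - (C - T)))"
      using assms(1) fin by (intro card_odd_comps_split) auto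
    moreover have "?Y - T = X - (S \<union> T)" "(?Y - T) - (C - T) = ?Y - C"
      using T by auto
    moreover have "card (odd_comps E ?Y) = card (odd_comps E C) + card (odd_comps E (?Y - C))"
      using assms(1) cl fin by (intro card_odd_comps_split) auto
    ultimately show ?thesis using S(2) by simp
  qed
  have finC: "finite C" if "C \<in> comps E (X - S)" for C
    using comps_subset[OF that] fin by (auto intro: finite_subset)
  have disj: "S \<inter> C = {}" "C \<subseteq> X" if "C \<in> comps E (X - S)" for C
    using comps_subset[OF that] by auto
  \<comment> \<open>Deleting one vertex of an even component leaves an odd number of vertices, hence
    a new odd component. The enlarged set would again be tight, against maximality of
    \<open>S\<close>.\<close>
  have odd_C: "odd (card C)" if C: "C \<in> comps E (X - S)" for C
  proof
    assume "even (card C)"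
    then have "odd_comps E C = {}"
      using comps_self[OF C] by (auto simp: odd_comps_def)
    obtain v where v: "v \<in> C" using comps_nonempty[OF C] by blast
    have "card C > 0" using v finC[OF C] by (auto simp: card_gt_0_iff)
    then have "odd (card (C - {v}))"
      using v \<open>even (card C)\<close> by simp
    then have "odd (card (odd_comps E (C - {v})))"
      using even_card_odd_comps[OF assms(1), of "C - {v}"] finC[OF C] by simp
    then have "card (odd_comps E (C - {v})) \<ge> 1"
      by (simp add: odd_pos Suc_leI)
    then have "card (odd_comps E (X - (S \<union> {v}))) \<ge> card S + 1"
      using split[OF C, of "{v}"] v \<open>odd_comps E C = {}\<close> by simp
    moreover have "card (S \<union> {v}) \<le> card S + 1"
      using card_Un_le[of S "{v}"] by simp
    moreover have "card (odd_comps E (X - (S \<union> {v}))) < card (S \<union> {v})"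
      using v disj[OF C] S(1) by (intro maximal) auto
    ultimately show False by linarith
  qed
  have odd_eq: "odd_comps E (X - S) = comps E (X - S)"
    using odd_C by (auto simp: odd_comps_def)
  have pm_C: "has_perfect_matching E (C - {c})" if C: "C \<in> comps E (X - S)" and c: "c \<in> C" for C c
  proof (rule less.hyps)
    have "C - {c} \<subset> X" using C c disj by blast
    then show "card (C - {c}) < card X" using fin by (rule psubset_card_mono[rotated])
    show "finite (C - {c})" using finC[OF C] by simp
    show "tutte_condition E (C - {c})"
      unfolding tutte_condition_def
    proof (intro allI impI)
      fix T assume T: "T \<subseteq> C - {c}"
      have fT: "finite T" using T finC[OF C] by (auto intro: finite_subset)
      show "card (odd_comps E (C - {c} - T)) \<le> card T"
      proof (rule ccontr)
        assume "\<not> ?thesis"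
        then have gt: "card (odd_comps E (C - {c} - T)) > card T" by simp
        \<comment> \<open>Since \<open>C\<close> is odd, \<open>C - {c} - T\<close> and
          \<open>T\<close> have sizes of equal parity, so a violation of the condition exceeds
          \<open>card T\<close> by at least 2.\<close>
        have "card C = card (C - {c} - T) + card T + 1"
        proof -
          have "C = insert c ((C - {c} - T) \<union> T)" using T c by auto
          also have "card \<dots> = card ((C - {c} - T) \<union> T) + 1"
            using T finC[OF C] fT by (subst card_insert_disjoint) auto
          also have "card ((C - {c} - T) \<union> T) = card (C - {c} - T) + card T"
            using finC[OF C] fT by (intro card_Un_disjoint) auto
          finally show ?thesis .
        qed
        then have "even (card (odd_comps E (C - {c} - T))) \<longleftrightarrow> even (card T)"
          using odd_C[OF C] even_card_odd_comps[OF assms(1), of "C - {c} - T"] finC[OF C] by simp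
        then have "card (odd_comps E (C - {c} - T)) \<noteq> card T + 1" by auto
        with gt have ge: "card (odd_comps E (C - {c} - T)) \<ge> card T + 2" by linarith
        have "odd_comps E C = {C}"
          using comps_self[OF C] odd_C[OF C] by (auto simp: odd_comps_def)
        moreover have "C - insert c T = C - {c} - T" by auto
        moreover have "insert c T \<subseteq> C" using T c by auto
        \<comment> \<open>One odd component, \<open>C\<close>, is traded for at least
          \<open>card T + 2\<close> others. The net gain \<open>card T + 1\<close> pays for all
          added vertices, which contradicts maximality.\<close>
        ultimately have "card (odd_comps E (X - (S \<union> insert c T))) \<ge> card S + card T + 1"
          using split[OF C, of "insert c T"] ge by simp
        moreover have "card (S \<union> insert c T) \<le> card S + card T + 1"
          using card_Un_le[of S "insert c T"] card_insert_le_m1[of "card T + 1" T c] by simp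
        moreover have "card (odd_comps E (X - (S \<union> insert c T))) < card (S \<union> insert c T)"
          using c T disj[OF C] S(1) by (intro maximal) auto
        ultimately show False by linarith
      qed
    qed
  qed
  \<comment> \<open>The vertices of \<open>S\<close> with a neighbour in \<open>C\<close>: the
    candidates to be matched into \<open>C\<close>.\<close>
  define A where "A C = {s \<in> S. \<exists>c\<in>C. E s c}" for C
  have "\<exists>R. (\<forall>C\<in>comps E (X - S). R C \<in> A C) \<and> inj_on R (comps E (X - S))"
  proof (rule hall_marriage)
    show "finite (comps E (X - S))" using fin by (simp add: finite_comps)
    show "finite (A C)" for C
      using S fin by (auto simp: A_def intro: finite_subset)
    fix J assume J: "J \<subseteq> comps E (X - S)"
    define N where "N = \<Union>(A ` J)"
    have "N \<subseteq> S" by (auto simp: N_def A_def)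
    \<comment> \<open>Every neighbour in \<open>S\<close> of a component from \<open>J\<close> lies
      in \<open>N\<close>, so putting \<open>S - N\<close> back does not enlarge these components.
      Tutte's condition for \<open>N\<close> is then Hall's condition for \<open>J\<close>.\<close>
    have "J \<subseteq> odd_comps E (X - N)"
    proof
      fix C assume "C \<in> J"
      then have C: "C \<in> comps E (X - S)" using J by blast
      have "\<not> E x y" if "x \<in> C" "y \<in> X - N - C" for x y
      proof
        assume "E x y"
        then have "E y x" using assms(1) by (auto dest: sympD)
        show False
        proof (cases "y \<in> S")
          case True
          then have "y \<in> N" using \<open>E y x\<close> \<open>C \<in> J\<close> that by (auto simp: N_def A_def)
          then show False using that by blast
        next
          case False
          then show False
            using comps_closed[OF C] that \<open>E x y\<close> by (auto simp: closed_in_def)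
        qed
      qed
      then have "closed_in E (X - N) C"
        using disj[OF C] \<open>N \<subseteq> S\<close> unfolding closed_in_def by blast
      then have "C \<in> comps E (X - N)"
        using comps_of_closed comps_self[OF C] by fastforce
      then show "C \<in> odd_comps E (X - N)"
        using odd_C[OF C] by (simp add: odd_comps_def)
    qed
    then have "card J \<le> card (odd_comps E (X - N))"
      using fin by (intro card_mono finite_odd_comps) auto
    also have "\<dots> \<le> card N"
      using \<open>N \<subseteq> S\<close> S by (intro tutte) auto
    finally show "card J \<le> card (\<Union>(A ` J))" by (simp add: N_def)
  qed
  then obtain R where R: "\<And>C. C \<in> comps E (X - S) \<Longrightarrow> R C \<in> A C"
    and inj: "inj_on R (comps E (X - S))" by blast
  \<comment> \<open>All components are odd and \<open>S\<close> is tight, so there are as many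
    components as vertices of \<open>S\<close>, and the injective choice uses up
    \<open>S\<close>.\<close>
  have "R ` comps E (X - S) = S"
  proof (rule card_subset_eq)
    show "finite S" using S fin by (auto intro: finite_subset)
    show "R ` comps E (X - S) \<subseteq> S" using R by (auto simp: A_def)
    show "card (R ` comps E (X - S)) = card S"
      using S(2) odd_eq card_image[OF inj] by simp
  qed
  have pm: "has_perfect_matching E (insert (R C) C)" if C: "C \<in> comps E (X - S)" for C
  proof -
    obtain c where c: "c \<in> C" "E (R C) c" "R C \<in> S" using R[OF C] by (auto simp: A_def)
    \<comment> \<open>The representative is matched to its neighbour \<open>c\<close>, and the rest
      of \<open>C\<close> is covered by \<open>pm_C\<close>.\<close>
    have "has_perfect_matching E ({R C, c} \<union> (C - {c}))"
      using pm_C[OF C c(1)] has_perfect_matching_pair[of E, OF c(2)] c disj[OF C] by (intro has_perfect_matching_Un) auto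
    moreover have "{R C, c} \<union> (C - {c}) = insert (R C) C" using c by auto
    ultimately show ?thesis by simp
  qed
  have "has_perfect_matching E (\<Union>C\<in>comps E (X - S). insert (R C) C)"
  proof (rule has_perfect_matching_UN)
    show "finite (comps E (X - S))" using fin by (simp add: finite_comps)
    fix C D assume CD: "C \<in> comps E (X - S)" "D \<in> comps E (X - S)" "C \<noteq> D"
    then have "R C \<noteq> R D" using inj by (auto dest: inj_onD)
    moreover have "R C \<in> S" "R D \<in> S" using R CD by (auto simp: A_def)
    ultimately show "insert (R C) C \<inter> insert (R D) D = {}"
      using disj CD comps_disjoint[OF CD] by blast
  qed (rule pm)
  moreover have "(\<Union>C\<in>comps E (X - S). insert (R C) C) = X"
  proof -
    have "(\<Union>C\<in>comps E (X - S). insert (R C) C) = R ` comps E (X - S) \<union> \<Union>(comps E (X - S))"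
      by auto
    then show ?thesis
      using \<open>R ` comps E (X - S) = S\<close> Union_comps[OF assms(1), of "X - S"] fin S by auto
  qed
  ultimately show ?case by simp
qed

section \<open>Components and connectedness of digraphs\<close>

lemma comps_cong:
  assumes "\<And>x y. x \<in> X \<Longrightarrow> y \<in> X \<Longrightarrow> E x y \<longleftrightarrow> E' x y"
  shows "comps E X = comps E' X"
proof -
  have "closed_in E X = closed_in E' X"
    using assms unfolding closed_in_def by (intro ext) blast
  then show ?thesis by (simp add: comps_def)
qed

lemma (in wf_digraph) reachable_closed_in:
  assumes "u \<rightarrow>\<^sup>* v" "closed_in (dominates G) (verts G) D" "u \<in> D"
  shows "v \<in> D"
  using assms(1)
proof (induction rule: reachable_induct)
  case base
  then show ?case using assms(3) by simp
next
  case (step x y)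
  then show ?case using assms(2) adj_in_verts(2) unfolding closed_in_def by blast
qed

lemma (in sym_digraph) not_connected_if_closed_in:
  assumes "closed_in (dominates G) (verts G) D" "D \<noteq> {}" "D \<noteq> verts G"
  shows "\<not> connected G"
proof
  assume conn: "connected G"
  have "D \<subseteq> verts G" using assms(1) by (simp add: closed_in_def)
  then obtain u v where "u \<in> D" "v \<in> verts G - D" "u \<in> verts G"
    using assms(2,3) by blast
  \<comment> \<open>\<open>connected\<close> refers to reachability in the symmetric closure, which
    agrees with reachability in \<open>G\<close> because the arcs are symmetric.\<close>
  then have "u \<rightarrow>\<^sup>* v"
    using conn reachable_mk_symmetric_eq[OF sym_arcs]
    by (auto simp: connected_def strongly_connected_def)
  then show False
    using reachable_closed_in assms(1) \<open>u \<in> D\<close> \<open>v \<in> verts G - D\<close> by blast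
qed

text \<open>The set reachable from a vertex is closed and so contains the atom of that vertex;
  conversely, no path leaves a closed set. Thus each atom is a full class of mutually reachable
  vertices.\<close>

lemma (in wf_digraph) comps_subset_sccs_verts:
  "comps (dominates G) (verts G) \<subseteq> sccs_verts"
proof
  fix C assume C: "C \<in> comps (dominates G) (verts G)"
  have "u \<rightarrow>\<^sup>* v" if "u \<in> C" "v \<in> C" for u v
  proof -
    have "u \<rightarrow>\<^sup>* u" using that comps_subset[OF C] by auto
    moreover have "closed_in (dominates G) (verts G) {v. u \<rightarrow>\<^sup>* v}"
      unfolding closed_in_def by (auto intro: reachable_adj_trans elim: reachable_in_vertsE)
    ultimately show ?thesis
      using comps_subset_closed[OF C] that by blast
  qed
  moreover have "\<not> u \<rightarrow>\<^sup>* v" if "u \<in> C" "v \<notin> C" for u v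
    using reachable_closed_in[OF _ comps_closed[OF C]] that by blast
  ultimately show "C \<in> sccs_verts"
    using comps_nonempty[OF C] unfolding sccs_verts_def by blast
qed

lemma (in fin_digraph) card_comps_le_num_components:
  "card (comps (dominates G) (verts G)) \<le> num_components G"
proof -
  have "sccs_verts \<subseteq> Pow (verts G)"
    by (auto simp: sccs_verts_def elim: reachable_in_vertsE)
  then have "finite sccs_verts"
    by (rule finite_subset) simp
  then show ?thesis
    using comps_subset_sccs_verts card_sccs_verts
    by (metis card_mono num_components_def)
qed

section \<open>Vertex cuts, toughness and connectivity\<close>

context graph
begin

lemma symp_dominates: "symp (dominates G)"
  using sym_arcs by (auto intro: sympI arcs_ends_symmetric)

lemma delete_verts_sym_digraph: "sym_digraph (delete_verts G S)"
  unfolding delete_verts_def by (rule induced_graph_imp_graph) auto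

lemma delete_verts_fin_digraph: "fin_digraph (delete_verts G S)"
proof -
  interpret H: sym_digraph "delete_verts G S" by (rule delete_verts_sym_digraph)
  show ?thesis
    by unfold_locales (auto simp: delete_verts_def)
qed

lemma comps_delete_verts:
  "comps (dominates (delete_verts G S)) (verts (delete_verts G S)) = comps (dominates G) (verts G - S)"
proof -
  have "comps (dominates (delete_verts G S)) (verts G - S) = comps (dominates G) (verts G - S)"
    by (rule comps_cong) (force simp: delete_verts_def arcs_ends_conv)
  then show ?thesis by (simp add: delete_verts_def)
qed

lemma card_comps_le_num_components_delete_verts:
  "card (comps (dominates G) (verts G - S)) \<le> num_components (delete_verts G S)"
  using fin_digraph.card_comps_le_num_components[OF delete_verts_fin_digraph]
  by (metis comps_delete_verts)

lemma vertex_cutI: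
  assumes "S \<subseteq> verts G" "closed_in (dominates G) (verts G - S) D" "D \<noteq> {}" "D \<noteq> verts G - S"
  shows "vertex_cut G S"
proof -
  have "closed_in (dominates (delete_verts G S)) (verts (delete_verts G S)) D"
    using assms(2) unfolding closed_in_def delete_verts_def
    by (auto dest: dominates_induce_subgraphD)
  moreover have "D \<noteq> verts (delete_verts G S)"
    using assms(4) by (simp add: delete_verts_def)
  ultimately have "\<not> connected (delete_verts G S)"
    using sym_digraph.not_connected_if_closed_in[OF delete_verts_sym_digraph] assms(3) by blast
  \<comment> \<open>The nonempty set \<open>D\<close> lies outside \<open>S\<close>, which gives the
    proper inclusion that \<open>vertex_cut\<close> demands.\<close>
  moreover have "S \<noteq> verts G"
    using assms(2,3) by (auto simp: closed_in_def)
  ultimately show ?thesis using assms(1) by (auto simp: vertex_cut_def)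
qed

lemma finite_vertex_cuts: "finite {S. vertex_cut G S}"
  by (rule finite_subset[of _ "Pow (verts G)"]) (auto simp: vertex_cut_def)

lemma toughness_le:
  assumes "vertex_cut G S"
  shows "toughness G \<le> real (card S) / real (num_components (delete_verts G S))"
  unfolding toughness_def
proof (rule Min_le)
  show "finite {real (card S) / real (num_components (delete_verts G S)) |S. vertex_cut G S}"
    using finite_vertex_cuts by simp
qed (use assms in blast)

lemma vertex_connectivity_le:
  assumes "vertex_cut G S"
  shows "vertex_connectivity G \<le> card S"
  unfolding vertex_connectivity_def
proof (rule Min_le)
  have "finite {S. S \<subseteq> verts G \<and> (vertex_cut G S \<or> card (verts G - S) = 1)}"
    by (rule finite_subset[of _ "Pow (verts G)"]) auto
  then show "finite {card S |S. S \<subseteq> verts G \<and> (vertex_cut G S \<or> card (verts G - S) = 1)}"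
    by simp
qed (use assms in \<open>auto simp: vertex_cut_def\<close>)

lemma vertex_cut_comps:
  assumes "S \<subseteq> verts G" "card (comps (dominates G) (verts G - S)) \<ge> 2"
  shows "vertex_cut G S"
proof -
  obtain C D where CD: "C \<in> comps (dominates G) (verts G - S)"
    "D \<in> comps (dominates G) (verts G - S)" "C \<noteq> D"
    using assms(2) card_le_Suc0_iff_eq[OF finite_comps, of "verts G - S" "dominates G"] by fastforce
  then have "C \<noteq> verts G - S"
    using comps_disjoint[OF CD] comps_nonempty[OF CD(2)] comps_subset[OF CD(2)] by blast
  then show ?thesis
    using assms(1) CD(1) by (auto intro: vertex_cutI comps_closed dest: comps_nonempty)
qed

text \<open>Deleting everything except two nonadjacent vertices is a vertex cut. This bound later
  yields the order condition of extendability.\<close>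

lemma vertex_connectivity_add_2_le_card:
  assumes "\<not> is_complete G"
  shows "vertex_connectivity G + 2 \<le> card (verts G)"
proof -
  have "arcs_ends G \<subseteq> {(u, v). (u, v) \<in> verts G \<times> verts G \<and> u \<noteq> v}"
    using adj_in_verts adj_not_same by auto
  then have "\<exists>u v. u \<in> verts G \<and> v \<in> verts G \<and> u \<noteq> v \<and> \<not> u \<rightarrow> v"
    using assms graph_axioms unfolding is_complete_def complete_digraph_def by blast
  then obtain u v where uv: "u \<in> verts G" "v \<in> verts G" "u \<noteq> v" "\<not> u \<rightarrow> v" by blast
  let ?S = "verts G - {u, v}"
  have "vertex_cut G ?S"
    using uv by (intro vertex_cutI[of _ "{u}"]) (auto simp: closed_in_def)
  then have "vertex_connectivity G \<le> card ?S" by (rule vertex_connectivity_le)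
  also have "card ?S = card (verts G) - 2"
    using uv by (subst card_Diff_subset) auto
  finally show ?thesis
    using uv card_mono[of "verts G" "{u, v}"] by simp
qed

section \<open>Matchings and their extension\<close>

lemma card_edge: "e \<in> edges G \<Longrightarrow> card e = 2"
  using no_loops by (auto simp: edges_def card_2_iff)

lemma matching_Union:
  assumes "matching G M"
  shows "\<Union>M \<subseteq> verts G" "card (\<Union>M) = 2 * card M"
proof -
  have M: "M \<subseteq> edges G" "pairwise disjnt M" using assms by (auto simp: matching_def)
  then show "\<Union>M \<subseteq> verts G" by (auto simp: edges_def)
  have "finite e" if "e \<in> M" for e
    using card_edge M that by (metis card.infinite subsetD zero_neq_numeral)
  then have "card (\<Union>M) = (\<Sum>e\<in>M. card e)"
    using M(2) by (intro card_Union_disjoint) auto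
  also have "\<dots> = (\<Sum>e\<in>M. 2)"
    using card_edge M(1) by (intro sum.cong) auto
  finally show "card (\<Union>M) = 2 * card M" by simp
qed

lemma perfect_matching_extend:
  assumes "matching G M" "has_perfect_matching (dominates G) (verts G - \<Union>M)"
  obtains M' where "perfect_matching G M'" "M \<subseteq> M'"
proof -
  have M: "M \<subseteq> edges G" "pairwise disjnt M" using assms(1) by (auto simp: matching_def)
  obtain N where N: "N \<subseteq> {{x, y} | x y. x \<rightarrow> y}" "pairwise disjnt N" "\<Union>N = verts G - \<Union>M"
    using assms(2) unfolding has_perfect_matching_def by blast
  have "N \<subseteq> edges G"
    using N(1) by (force simp: edges_def arcs_ends_conv)
  moreover have "disjnt e f" if "e \<in> M" "f \<in> N" for e f
    using that N(3) unfolding disjnt_def by blast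
  then have "pairwise disjnt (M \<union> N)"
    using M(2) N(2) unfolding pairwise_def by (metis Un_iff disjnt_sym)
  moreover have "\<Union>(M \<union> N) = verts G"
    using N(3) matching_Union(1)[OF assms(1)] by auto
  ultimately have "perfect_matching G (M \<union> N)"
    using M(1) by (auto simp: perfect_matching_def matching_def)
  then show thesis using that by blast
qed

text \<open>The bound is in terms of \<open>card M\<close>, so that one argument serves both the
  given matching and the empty one. Subtraction is real: for \<open>M = {}\<close> the right-hand
  side is negative.\<close>

lemma matching_extends_if_tough:
  assumes "even (card (verts G))" "\<epsilon> > 0" "toughness G \<ge> 1 + \<epsilon>"
    and conn: "real (vertex_connectivity G) > (2 * real (card M) - 2) * (1 + \<epsilon>) / \<epsilon>"
    and M: "matching G M"
  obtains M' where "perfect_matching G M'" "M \<subseteq> M'"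
proof -
  let ?E = "dominates G"
  let ?X = "verts G - \<Union>M"
  note U = matching_Union[OF M]
  have finU: "finite (\<Union>M)" using U(1) finite_verts by (rule finite_subset)
  have "tutte_condition ?E ?X"
    unfolding tutte_condition_def
  proof (intro allI impI, rule ccontr)
    fix T assume T: "T \<subseteq> ?X" and "\<not> card (odd_comps ?E (?X - T)) \<le> card T"
    then have gt: "card T < card (odd_comps ?E (?X - T))" by simp
    have finT: "finite T" using T by (auto intro: finite_subset)
    define S where "S = \<Union>M \<union> T"
    have S: "S \<subseteq> verts G" "verts G - S = ?X - T" using U(1) T by (auto simp: S_def)
    have card_S: "card S = 2 * card M + card T"
      unfolding S_def using T finU finT U(2) by (subst card_Un_disjoint) auto
    have "card (verts G) = card (?X - T) + card S"
      using S card_Diff_subset[of S "verts G"] card_mono[of "verts G" S]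
      by (simp add: finite_subset)
    \<comment> \<open>Both \<open>card (verts G)\<close> and \<open>card (\<Union>M)\<close> are
      even, so the number of odd components has the parity of \<open>card T\<close>; an excess of
      exactly 1 is impossible.\<close>
    then have "even (card (odd_comps ?E (?X - T))) \<longleftrightarrow> even (card T)"
      using even_card_odd_comps[OF symp_dominates, of "?X - T"] assms(1) card_S
      by (metis even_add even_mult_iff dvd_refl finite_Diff finite_verts)
    then have "card (odd_comps ?E (?X - T)) \<noteq> card T + 1" by auto
    then have "card T + 2 \<le> card (odd_comps ?E (?X - T))" using gt by linarith
    also have "\<dots> \<le> card (comps ?E (?X - T))"
      by (intro card_mono finite_comps) (auto simp: odd_comps_def)
    finally have comps: "card T + 2 \<le> card (comps ?E (verts G - S))" by (simp add: S)
    then have cut: "vertex_cut G S" using S(1) by (intro vertex_cut_comps) auto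
    define c where "c = real (num_components (delete_verts G S))"
    have c: "c \<ge> real (card T) + 2"
      using comps card_comps_le_num_components_delete_verts[of S] by (simp add: c_def)
    have "1 + \<epsilon> \<le> real (card S) / c"
      using toughness_le[OF cut] assms(3) by (simp add: c_def)
    then have "(1 + \<epsilon>) * c \<le> real (card S)"
      using c by (simp add: pos_le_divide_eq)
    moreover have "(1 + \<epsilon>) * (real (card T) + 2) \<le> (1 + \<epsilon>) * c"
      using c assms(2) by (intro mult_left_mono) auto
    \<comment> \<open>Here \<open>card T\<close> is rewritten as \<open>card S - 2 * card M\<close>.
      Cancelling one copy of \<open>card S\<close> then leaves the factor \<epsilon> on the
      left.\<close>
    ultimately have "(1 + \<epsilon>) * (real (card S) - 2 * real (card M) + 2) \<le> real (card S)"
      by (simp add: card_S)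
    then have "\<epsilon> * real (card S) \<le> (2 * real (card M) - 2) * (1 + \<epsilon>)"
      by (simp add: algebra_simps)
    then have "real (card S) \<le> (2 * real (card M) - 2) * (1 + \<epsilon>) / \<epsilon>"
      using assms(2) by (simp add: pos_le_divide_eq mult.commute)
    then show False
      using conn vertex_connectivity_le[OF cut] by linarith
  qed
  then have "has_perfect_matching ?E ?X"
    using symp_dominates by (intro tutte_theorem) auto
  with M show thesis by (rule perfect_matching_extend) (rule that)
qed

end

section \<open>Extendability from toughness and connectivity\<close>

theorem corollary3p2:
  fixes G :: "('a, 'b) pre_digraph" and k :: nat and \<epsilon> :: real
  assumes "k \<ge> 1"
    and "\<epsilon> > 0"
    and "Digraph.graph G"
    and "Digraph_Component.connected G"
    and "\<not> is_complete G"
    and "even (card (verts G))"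
    and "toughness G \<ge> 1 + \<epsilon>"
    and "real (vertex_connectivity G) > (2 * real k - 2) * (1 + \<epsilon>) / \<epsilon>"
  shows "k_extendable G k"
proof -
  interpret graph G by fact
  have extends: "\<exists>M'. perfect_matching G M' \<and> M \<subseteq> M'"
    if "matching G M" "card M \<le> k" for M
  proof -
    \<comment> \<open>The bound increases with the size of the matching, so the hypothesis for
      \<open>k\<close> covers every smaller matching.\<close>
    have "(2 * real (card M) - 2) * (1 + \<epsilon>) / \<epsilon> \<le> (2 * real k - 2) * (1 + \<epsilon>) / \<epsilon>"
      using that(2) assms(2) by (intro divide_right_mono mult_right_mono) auto
    then show ?thesis
      using matching_extends_if_tough[OF assms(6,2,7) _ that(1)] assms(8)
      by (metis order_le_less_trans)
  qed
  \<comment> \<open>The factor (1 + \<epsilon>)/\<epsilon> exceeds 1 and \<open>2 * k - 2\<close> is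
    nonnegative, so the connectivity is greater than \<open>2 * k - 2\<close>.\<close>
  have "2 * real k - 2 \<le> (2 * real k - 2) * (1 + \<epsilon>) / \<epsilon>"
    using assms(1,2) by (simp add: pos_le_divide_eq mult_left_mono)
  then have "2 * k < vertex_connectivity G + 2"
    using assms(8) by linarith
  then have "2 * k + 1 \<le> card (verts G)"
    using vertex_connectivity_add_2_le_card[OF assms(5)] by linarith
  \<comment> \<open>Even order raises the bound \<open>2 * k + 1\<close> by one.\<close>
  then have "2 * k + 2 \<le> card (verts G)"
    using assms(6) by presburger
  \<comment> \<open>Extending the empty matching gives a perfect matching.\<close>
  moreover have "\<exists>M. perfect_matching G M"
    using extends[of "{}"] by (auto simp: matching_def)
  ultimately show ?thesis
    using assms(4) extends by (auto simp: k_extendable_def k_matching_def)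
qed

end
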